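(* Let $f:\mathbb{R}^n\to\mathbb{R}^n$ be a function, $F:\mathbb{R}^n\rightrightarrows\mathbb{R}^n$ a set-valued map and $p:[0,1]\to\mathbb{R}^n$ a function. For $t\in[0,1]$ let $G_t(v)=f(v)-p(t)+F(v)$ and $S(t)=\{z\in\mathbb{R}^n : 0\in G_t(z)\}$. Assume that (i) $z:[0,1]\to\mathbb{R}^n$ is a continuous solution trajectory, i.e. $z$ is continuous and $z(t)\in S(t)$ for all $t\in[0,1]$; (ii) $p$ is Lipschitz continuous; (iii) for every $t\in[0,1]$, $G_t$ is strongly metrically regular at $z(t)$ for $0$. Then $z$ is a Lipschitz continuous function on $[0,1]$.
   Context: For a set-valued map $H:\mathbb{R}^n\rightrightarrows\mathbb{R}^n$, $H^{-1}(y)=\{x: y\in H(x)\}$. $\mathbb{B}_r(x)$ denotes the closed ball of radius $r$ centred at $x$. $G_t$ is strongly metrically regular at $z(t)$ for $0$ if $0\in G_t(z(t))$ and there exist constants $a_t,b_t,\kappa_t>0$ such that the mapping $\mathbb{B}_{b_t}(0)\ni y\mapsto G_t^{-1}(y)\cap\mathbb{B}_{a_t}(z(t))$ is single-valued (exactly one value for each $y$) and Lipschitz continuous with Lipschitz constant $\kappa_t$. *)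

theory Defs
  imports "HOL-Analysis.Analysis"
begin

text \<open>A set-valued map from X to Y is a function of type \<open>'a \<Rightarrow> 'b set\<close>; the value may be empty.\<close>

definition setmap_inverse :: "('a \<Rightarrow> 'b set) \<Rightarrow> 'b \<Rightarrow> 'a set" where
  "setmap_inverse H y = {x. y \<in> H x}"

text \<open>The function \<open>s\<close> below is the single-valued localization of the inverse around \<open>y0\<close>:
  at every \<open>y\<close> in the ball the localized inverse has exactly one value, namely \<open>s y\<close>.\<close>

definition strongly_metrically_regular ::
    "('a::metric_space \<Rightarrow> 'b::metric_space set) \<Rightarrow> 'a \<Rightarrow> 'b \<Rightarrow> bool" where
  "strongly_metrically_regular H x0 y0 \<longleftrightarrow>
     y0 \<in> H x0 \<and>
     (\<exists>a>0. \<exists>b>0. \<exists>\<kappa>>0. \<exists>s.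
        (\<forall>y\<in>cball y0 b. setmap_inverse H y \<inter> cball x0 a = {s y}) \<and>
        \<kappa>-lipschitz_on (cball y0 b) s)"

definition gen_eq_map ::
    "(real^'n \<Rightarrow> real^'n) \<Rightarrow> (real^'n \<Rightarrow> (real^'n) set) \<Rightarrow> (real \<Rightarrow> real^'n)
      \<Rightarrow> real \<Rightarrow> real^'n \<Rightarrow> (real^'n) set" where
  "gen_eq_map f F p t v = {f v - p t + w | w. w \<in> F v}"

definition solution_set ::
    "(real^'n \<Rightarrow> real^'n) \<Rightarrow> (real^'n \<Rightarrow> (real^'n) set) \<Rightarrow> (real \<Rightarrow> real^'n)
      \<Rightarrow> real \<Rightarrow> (real^'n) set" where
  "solution_set f F p t = {z. 0 \<in> gen_eq_map f F p t z}"

end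

theory Submission
  imports Defs
begin

text \<open>Since \<open>p u - p t \<in> G\<^sub>t (z u)\<close>, for \<open>u\<close> near \<open>t\<close> continuity forces \<open>z u\<close> to be the value at
  \<open>p u - p t\<close> of the single-valued localization of the inverse of \<open>G\<^sub>t\<close>. So \<open>z\<close> is locally a
  composition of Lipschitz maps, and a locally Lipschitz map on a compact set is Lipschitz.\<close>

text \<open>The maps at times \<open>u\<close> and \<open>t\<close> differ only by the constant
  shift \<open>p u - p t\<close>, so a zero of the one at \<open>u\<close> turns into a solution of
  the one at \<open>t\<close> with this shift on the right-hand side.\<close>

lemma diff_in_gen_eq_map:
  assumes "v \<in> solution_set f F p u"
  shows "p u - p t \<in> gen_eq_map f F p t v"
proof -
  from assms obtain w where "w \<in> F v" "f v - p u + w = 0"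
    by (force simp: solution_set_def gen_eq_map_def)
  moreover from this have "p u - p t = f v - p t + w"
    by (simp add: algebra_simps)
  ultimately show ?thesis
    by (auto simp: gen_eq_map_def)
qed

text \<open>The constant obtained is \<open>\<kappa> * L\<close> with \<open>\<kappa>\<close> coming
  from the regularity at \<open>t\<close>, so both it and the radius may vary with \<open>t\<close>;
  uniformity is left to compactness.\<close>

lemma lipschitz_on_near_strongly_regular:
  fixes z :: "real \<Rightarrow> real^'n"
  assumes cont: "continuous_on T z"
    and sol: "\<And>u. u \<in> T \<Longrightarrow> z u \<in> solution_set f F p u"
    and lip: "L-lipschitz_on T p"
    and t: "t \<in> T"
    and reg: "strongly_metrically_regular (gen_eq_map f F p t) (z t) 0"
  shows "\<exists>d>0. \<exists>M. M-lipschitz_on (cball t d \<inter> T) z"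
proof -
  from reg obtain a b \<kappa> s where "a > 0" "b > 0"
    and s: "\<And>y. y \<in> cball 0 b \<Longrightarrow>
        setmap_inverse (gen_eq_map f F p t) y \<inter> cball (z t) a = {s y}"
    and s_lip: "\<kappa>-lipschitz_on (cball 0 b) s"
    unfolding strongly_metrically_regular_def by metis
  obtain d1 where "d1 > 0" and d1: "\<And>u. u \<in> T \<Longrightarrow> dist u t < d1 \<Longrightarrow> dist (z u) (z t) < a"
    using cont t \<open>a > 0\<close> unfolding continuous_on_iff by metis
  obtain d2 where "d2 > 0" and d2: "\<And>u. u \<in> T \<Longrightarrow> dist u t < d2 \<Longrightarrow> dist (p u) (p t) < b"
    using lipschitz_on_continuous_on[OF lip] t \<open>b > 0\<close> unfolding continuous_on_iff by metis
  \<comment> \<open>Halving makes the closed ball of radius \<open>d\<close> fit inside the open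
    conditions given by \<open>d1\<close> (which keeps \<open>z u\<close> within \<open>a\<close>)
    and \<open>d2\<close> (which keeps \<open>p u - p t\<close> within \<open>b\<close>).\<close>
  define d where "d = min d1 d2 / 2"
  have "d > 0" "d < d1" "d < d2"
    using \<open>d1 > 0\<close> \<open>d2 > 0\<close> by (auto simp: d_def)
  have p_near: "p u - p t \<in> cball 0 b" if "u \<in> cball t d \<inter> T" for u
    using d2[of u] that \<open>d < d2\<close> by (auto simp: dist_commute dist_norm norm_minus_commute)
  have z_eq: "z u = s (p u - p t)" if u: "u \<in> cball t d \<inter> T" for u
  proof -
    have "z u \<in> cball (z t) a"
      using d1[of u] u \<open>d < d1\<close> by (auto simp: dist_commute)
    moreover have "z u \<in> setmap_inverse (gen_eq_map f F p t) (p u - p t)"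
      using sol u by (simp add: setmap_inverse_def diff_in_gen_eq_map)
    ultimately show ?thesis
      using s[OF p_near[OF u]] by blast
  qed
  have "L-lipschitz_on (cball t d \<inter> T) (\<lambda>u. p u - p t)"
    using lipschitz_on_subset[OF lip, of "cball t d \<inter> T"]
    by (auto simp: lipschitz_on_def dist_norm)
  \<comment> \<open>The composition only needs \<open>s\<close> on the image of the inner map, which
    the choice of \<open>d2\<close> confines to the ball where \<open>s\<close> is
    Lipschitz.\<close>
  moreover have "\<kappa>-lipschitz_on ((\<lambda>u. p u - p t) ` (cball t d \<inter> T)) s"
    by (rule lipschitz_on_subset[OF s_lip]) (rule image_subsetI, rule p_near)
  ultimately have "(\<kappa> * L)-lipschitz_on (cball t d \<inter> T) (\<lambda>u. s (p u - p t))"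
    by (rule lipschitz_on_compose2)
  then have "(\<kappa> * L)-lipschitz_on (cball t d \<inter> T) z"
    using z_eq by (simp add: lipschitz_on_def)
  with \<open>d > 0\<close> show ?thesis
    by blast
qed

theorem corollary4p2p6:
  fixes f :: "real^'n \<Rightarrow> real^'n"
    and F :: "real^'n \<Rightarrow> (real^'n) set"
    and p z :: "real \<Rightarrow> real^'n"
  assumes "continuous_on {0..1} z"
    and "\<forall>t\<in>{0..1}. z t \<in> solution_set f F p t"
    and "\<exists>L. L-lipschitz_on {0..1} p"
    and "\<forall>t\<in>{0..1}. strongly_metrically_regular (gen_eq_map f F p t) (z t) 0"
  shows "\<exists>L. L-lipschitz_on {0..1} z"
proof -
  \<comment> \<open>\<open>local_lipschitz\<close> concerns families of maps with a parameter;
    \<open>z\<close> enters as a constant family over the dummy parameter set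
    \<open>{0}\<close>.\<close>
  have "local_lipschitz {0::real} {0..1} (\<lambda>_. z)"
  proof (rule local_lipschitzI)
    fix t x :: real
    assume "x \<in> {0..1}"
    with assms obtain d M where "d > 0" "M-lipschitz_on (cball x d \<inter> {0..1}) z"
      using lipschitz_on_near_strongly_regular[of "{0..1}" z f F p _ x] by blast
    then show "\<exists>u>0. \<exists>L. \<forall>t\<in>cball t u \<inter> {0}. L-lipschitz_on (cball x u \<inter> {0..1}) z"
      by blast
  qed
  \<comment> \<open>Compactness of \<open>{0..1}\<close> merges the local constants into one;
    continuity in the dummy parameter is trivial.\<close>
  then obtain L where "\<And>t. t \<in> {0::real} \<Longrightarrow> L-lipschitz_on {0..1} z"
    using local_lipschitz_compact_implies_lipschitz[of "{0::real}" "{0..1}" "\<lambda>_. z"]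
    by (metis compact_Icc compact_sing continuous_on_const)
  then show ?thesis
    by blast
qed

end
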